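(* Let $n\geq 3$, let $N=\{1,\ldots,n\}$ be a set of $n$ agents and $O=\{o_1,\ldots,o_n\}$ a set of $n$ objects, and let $\mathcal{R}(O)$ be the set of all complete and transitive binary relations on $O$ (indifferences allowed). Then there exists no random assignment rule $f$, defined on all preference profiles in $\mathcal{R}(O)^n$, that is simultaneously (1) an extension of the probabilistic serial rule (PS), (2) ex post efficient, and (3) weak SD-strategyproof.
   Context: Setting. A preference profile is a tuple $\succsim=(\succsim_1,\ldots,\succsim_n)\in\mathcal{R}(O)^n$, where $\succsim_i$ is the preference relation of agent $i$ over objects; $\succ_i$ and $\sim_i$ denote its strict and indifference parts. The preference $\succsim_i$ is strict if $o\sim_i o'$ implies $o=o'$. A random assignment is an $n\times n$ matrix $p=[p(i)(o_j)]$ with entries in $[0,1]$, with $\sum_{i\in N}p(i)(o_j)=1$ for every $j$ and $\sum_{o_j\in O}p(i)(o_j)=1$ for every $i$; $p(i)(o_j)$ is the probability that agent $i$ gets $o_j$, and the row $p(i)$ is the allocation of agent $i$. It is discrete if all entries are in $\{0,1\}$. A random assignment rule is a function $f$ assigning to each preference profile $\succsim\in\mathcal{R}(O)^n$ a random assignment $f(\succsim)$. Stochastic dominance (SD). For random assignments $p,q$, write $p(i)\succsim_i^{SD}q(i)$ if for all $o\in O$, $$\sum_{o_j\in\{o_k: o_k\succsim_i o\}}p(i)(o_j)\;\geq\;\sum_{o_j\in\{o_k: o_k\succsim_i o\}}q(i)(o_j).$$ Write $p(i)\succ_i^{SD}q(i)$ if $p(i)\succsim_i^{SD}q(i)$ and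 not $q(i)\succsim_i^{SD}p(i)$. Efficiency. An assignment $p$ is SD-efficient (with respect to $\succsim$) if there is no assignment $q$ with $q(i)\succsim_i^{SD}p(i)$ for all $i\in N$ and $q(i)\succ_i^{SD}p(i)$ for some $i\in N$. A discrete assignment is Pareto optimal if and only if it is SD-efficient; equivalently, no other discrete assignment gives every agent an object at least as preferred and some agent a strictly preferred object. A random assignment is ex post efficient if it can be represented as a probability distribution over (i.e. is a convex combination of) Pareto optimal discrete assignments. A rule $f$ is ex post efficient if $f(\succsim)$ is ex post efficient with respect to $\succsim$ for every profile $\succsim$. Strategyproofness. A rule $f$ is weak SD-strategyproof if for every agent $i\in N$, every $\succsim_i,\succsim_i'\in\mathcal{R}(O)$ and every $\succsim_{-i}\in\mathcal{R}(O)^{n-1}$ (preferences of the other agents), it is not the case that $f(\succsim_i',\succsim_{-i})(i)\succ_i^{SD}f(\succsim_i,\succsim_{-i})(i)$, where $\succ_i^{SD}$ is taken with respect to $\succsim_i$. Probabilistic serial rule (PS). It is defined on profiles in which all agents have strict preferences. Each object is regarded as an infinitely divisible unit amount. During the time interval $[0,1]$ all agents simultaneously eat at the same unit rate; at each moment each agent eats its most preferred object among those not yet completely eaten, moving on to its next most preferred available object when the current one is exhausted. $PS(\succsim)(i)(o)$ is the fraction of object $o$ eaten by agent $i$ by the end (time $1$). A random assignment rule $f$ is an extension of PS if $f(\succsim)=PS(\succsim)$ for every preference profile $\succsim$ in which the preferences of all agents are strict. *)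

theory Defs
  imports "HOL-Analysis.Analysis"
begin

text \<open>
  Agents and objects are the elements of two finite types \<open>'a\<close> and \<open>'o\<close>. A preference
  relation \<open>R\<close> is read as ``weakly preferred'': \<open>R x y\<close> means that \<open>x\<close> is at least as good as
  \<open>y\<close>. An assignment is a matrix \<open>p\<close>, where \<open>p $ i $ x\<close> is the probability that agent \<open>i\<close>
  gets object \<open>x\<close>.
\<close>

type_synonym 'o pref = "'o \<Rightarrow> 'o \<Rightarrow> bool"
type_synonym ('a, 'o) profile = "'a \<Rightarrow> 'o pref"
type_synonym ('a, 'o) assignment = "real ^ 'o ^ 'a"

definition preferences :: "'o pref set" where
  "preferences = {R. (\<forall>x y. R x y \<or> R y x) \<and> transp R}"

definition strict_pref :: "'o pref \<Rightarrow> bool" where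
  "strict_pref R \<longleftrightarrow> (\<forall>x y. R x y \<and> R y x \<longrightarrow> x = y)"

definition profiles :: "('a, 'o) profile set" where
  "profiles = {R. \<forall>i. R i \<in> preferences}"

definition random_assignment :: "('a::finite, 'o::finite) assignment \<Rightarrow> bool" where
  "random_assignment p \<longleftrightarrow>
     (\<forall>i x. 0 \<le> p $ i $ x \<and> p $ i $ x \<le> 1) \<and>
     (\<forall>x. (\<Sum>i\<in>UNIV. p $ i $ x) = 1) \<and>
     (\<forall>i. (\<Sum>x\<in>UNIV. p $ i $ x) = 1)"

definition discrete_assignment :: "('a::finite, 'o::finite) assignment \<Rightarrow> bool" where
  "discrete_assignment p \<longleftrightarrow> random_assignment p \<and> (\<forall>i x. p $ i $ x \<in> {0, 1})"


definition sd_weak :: "'o::finite pref \<Rightarrow> real ^ 'o \<Rightarrow> real ^ 'o \<Rightarrow> bool" where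
  "sd_weak R a b \<longleftrightarrow> (\<forall>y. (\<Sum>x\<in>{x. R x y}. a $ x) \<ge> (\<Sum>x\<in>{x. R x y}. b $ x))"

definition sd_strict :: "'o::finite pref \<Rightarrow> real ^ 'o \<Rightarrow> real ^ 'o \<Rightarrow> bool" where
  "sd_strict R a b \<longleftrightarrow> sd_weak R a b \<and> \<not> sd_weak R b a"

definition sd_efficient ::
    "('a::finite, 'o::finite) profile \<Rightarrow> ('a, 'o) assignment \<Rightarrow> bool" where
  "sd_efficient R p \<longleftrightarrow>
     \<not> (\<exists>q. random_assignment q \<and>
            (\<forall>i. sd_weak (R i) (q $ i) (p $ i)) \<and> (\<exists>i. sd_strict (R i) (q $ i) (p $ i)))"

definition pareto_optimal ::
    "('a::finite, 'o::finite) profile \<Rightarrow> ('a, 'o) assignment \<Rightarrow> bool" where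
  "pareto_optimal R p \<longleftrightarrow> discrete_assignment p \<and> sd_efficient R p"

definition ex_post_efficient ::
    "('a::finite, 'o::finite) profile \<Rightarrow> ('a, 'o) assignment \<Rightarrow> bool" where
  "ex_post_efficient R p \<longleftrightarrow> p \<in> convex hull {q. pareto_optimal R q}"


text \<open>
  The probabilistic serial rule. A state of the eating process is the matrix \<open>p\<close> of the
  amounts eaten so far. The set of objects still available changes only at the moments at which
  some object is exhausted, so the process is described by the phases between these moments.
  For strict preferences \<open>ps_eats R p i x\<close> holds for exactly one \<open>x\<close> as long as some object is
  available.
\<close>

definition ps_available :: "('a::finite, 'o::finite) assignment \<Rightarrow> 'o set" where
  "ps_available p = {x. (\<Sum>i\<in>UNIV. p $ i $ x) < 1}"

definition ps_eats ::
    "('a::finite, 'o::finite) profile \<Rightarrow> ('a, 'o) assignment \<Rightarrow> 'a \<Rightarrow> 'o \<Rightarrow> bool" where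
  "ps_eats R p i x \<longleftrightarrow> x \<in> ps_available p \<and> (\<forall>y\<in>ps_available p. R i x y)"

text \<open>
  The time until the next object is exhausted: \<open>k\<close> agents eating from \<open>x\<close> at unit rate
  exhaust it after (remaining amount of \<open>x\<close>) \<open>/ k\<close> time units. When no object is available the
  value is unspecified, but then it is not used, since nobody eats.
\<close>

definition ps_duration ::
    "('a::finite, 'o::finite) profile \<Rightarrow> ('a, 'o) assignment \<Rightarrow> real" where
  "ps_duration R p =
     Min {(1 - (\<Sum>i\<in>UNIV. p $ i $ x)) / real (card {i. ps_eats R p i x}) | x.
            {i. ps_eats R p i x} \<noteq> {}}"

definition ps_phase ::
    "('a::finite, 'o::finite) profile \<Rightarrow> ('a, 'o) assignment \<Rightarrow> ('a, 'o) assignment" where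
  "ps_phase R p = (\<chi> i x. p $ i $ x + (if ps_eats R p i x then ps_duration R p else 0))"

text \<open>
  Every phase exhausts at least one object, hence \<open>CARD('o)\<close> phases suffice, and further phases
  change nothing. With as many agents as objects the process then has reached time \<open>1\<close>: see
  \<open>random_assignment_PS\<close> below.
\<close>

definition PS :: "('a::finite, 'o::finite) profile \<Rightarrow> ('a, 'o) assignment" where
  "PS R = (ps_phase R ^^ CARD('o)) 0"

lemma ps_eats_ex1:
  fixes R :: "('a::finite, 'o::finite) profile"
  assumes "R i \<in> preferences" "strict_pref (R i)" "ps_available p \<noteq> {}"
  shows "\<exists>!x. ps_eats R p i x"
proof -
  have tot: "R i x y \<or> R i y x" and tr: "R i x y \<Longrightarrow> R i y z \<Longrightarrow> R i x z" for x y z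
    using assms(1) by (auto simp: preferences_def dest: transpD)
  have "A \<noteq> {} \<Longrightarrow> \<exists>x\<in>A. \<forall>y\<in>A. R i x y" if "finite A" for A
    using that
  proof (induction A rule: finite_induct)
    case (insert a A)
    show ?case
    proof (cases "A = {}")
      case True
      then show ?thesis using tot[of a a] by auto
    next
      case False
      then obtain x where "x \<in> A" "\<forall>y\<in>A. R i x y" using insert.IH by blast
      then show ?thesis using tot[of a x] tot[of a a] tr by (metis insert_iff)
    qed
  qed simp
  then have "\<exists>x. ps_eats R p i x"
    using assms(3) by (auto simp: ps_eats_def)
  moreover have "x = y" if "ps_eats R p i x" "ps_eats R p i y" for x y
    using that assms(2) by (auto simp: ps_eats_def strict_pref_def)
  ultimately show ?thesis by blast
qed

lemma random_assignment_PS: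
  fixes R :: "('a::finite, 'o::finite) profile"
  assumes "R \<in> profiles" "\<And>i. strict_pref (R i)" and card: "CARD('a) = CARD('o)"
  shows "random_assignment (PS R)"
proof -
  define col where "col p x = (\<Sum>i\<in>UNIV. p $ i $ x)" for p :: "('a, 'o) assignment" and x
  define I where "I p \<longleftrightarrow> (\<forall>i x. 0 \<le> p $ i $ x) \<and> (\<forall>x. col p x \<le> 1) \<and>
      (\<exists>t. \<forall>i. (\<Sum>x\<in>UNIV. p $ i $ x) = t)" for p :: "('a, 'o) assignment"
  have ex1: "\<exists>!x. ps_eats R p i x" if "ps_available p \<noteq> {}" for p i
    using that assms by (intro ps_eats_ex1) (auto simp: profiles_def)
  have phase: "I (ps_phase R p) \<and> card (ps_available (ps_phase R p)) \<le> card (ps_available p) - 1"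
    if p: "I p" for p
  proof (cases "ps_available p = {}")
    case True
    then have "ps_phase R p = p"
      by (simp add: ps_phase_def ps_eats_def vec_eq_iff)
    then show ?thesis using p True by simp
  next
    case False
    let ?d = "ps_duration R p" and ?k = "\<lambda>x. card {i. ps_eats R p i x}"
    let ?D = "{(1 - col p x) / real (?k x) | x. {i. ps_eats R p i x} \<noteq> {}}"
    have d: "?d = Min ?D" by (simp add: ps_duration_def col_def)
    have fin: "finite ?D" by simp
    have ne: "?D \<noteq> {}" using ex1[OF False] by blast
    obtain z where z: "?d = (1 - col p z) / real (?k z)" "{i. ps_eats R p i z} \<noteq> {}"
      using Min_in[OF fin ne] d by auto
    then have kz: "?k z > 0" by (simp add: card_gt_0_iff)
    have z_av: "z \<in> ps_available p" using z(2) by (auto simp: ps_eats_def)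
    have d0: "?d > 0" using z kz z_av by (simp add: ps_available_def col_def)
    have colp: "col (ps_phase R p) x = col p x + real (?k x) * ?d" for x
      by (simp add: col_def ps_phase_def sum.distrib sum.If_cases)
    have le1: "col (ps_phase R p) x \<le> 1" for x
    proof (cases "{i. ps_eats R p i x} = {}")
      case True
      then show ?thesis using p colp[of x] by (simp add: I_def)
    next
      case ne: False
      then have "?d \<le> (1 - col p x) / real (?k x)"
        unfolding d by (intro Min_le[OF fin]) blast
      moreover have "real (?k x) > 0" using ne by (simp add: card_gt_0_iff)
      ultimately show ?thesis by (simp add: colp field_simps)
    qed
    have "col (ps_phase R p) z = 1" using z kz by (simp add: colp)
    then have "z \<notin> ps_available (ps_phase R p)" by (simp add: ps_available_def col_def)
    moreover have "col p x \<le> col (ps_phase R p) x" for x using d0 by (simp add: colp)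
    then have "ps_available (ps_phase R p) \<subseteq> ps_available p"
      unfolding ps_available_def col_def by (auto intro: le_less_trans)
    ultimately have "ps_available (ps_phase R p) \<subset> ps_available p" using z_av by blast
    then have "card (ps_available (ps_phase R p)) < card (ps_available p)"
      by (intro psubset_card_mono) auto
    moreover obtain t where t: "\<And>i. (\<Sum>x\<in>UNIV. p $ i $ x) = t" using p by (auto simp: I_def)
    have "(\<Sum>x\<in>UNIV. ps_phase R p $ i $ x) = t + ?d" for i
    proof -
      obtain x where "ps_eats R p i = (\<lambda>y. y = x)" using ex1[OF False, of i] by blast
      then show ?thesis using t[of i] by (simp add: ps_phase_def sum.distrib)
    qed
    moreover have "0 \<le> ps_phase R p $ i $ x" for i x
      using p d0 by (simp add: ps_phase_def I_def)
    ultimately show ?thesis using le1 by (auto simp: I_def)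
  qed
  have "I 0" by (simp add: I_def col_def)
  have "I ((ps_phase R ^^ k) 0) \<and> card (ps_available ((ps_phase R ^^ k) 0)) \<le> CARD('o) - k" for k
  proof (induction k)
    case 0
    show ?case using \<open>I 0\<close> by (simp add: card_mono)
  next
    case (Suc k)
    then show ?case using phase[of "(ps_phase R ^^ k) 0"] by auto
  qed
  from this[of "CARD('o)"] have *: "I (PS R)" "ps_available (PS R) = {}"
    by (auto simp: PS_def)
  then have col1: "col (PS R) x = 1" for x
    by (auto simp: I_def ps_available_def col_def not_less intro: antisym)
  obtain t where t: "\<And>i. (\<Sum>x\<in>UNIV. PS R $ i $ x) = t" using *(1) by (auto simp: I_def)
  have "real CARD('a) * t = (\<Sum>i\<in>UNIV. \<Sum>x\<in>UNIV. PS R $ i $ x)" by (simp add: t)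
  also have "\<dots> = (\<Sum>x\<in>UNIV. col (PS R) x)" unfolding col_def by (rule sum.swap)
  finally have "t = 1" by (simp add: col1 card)
  moreover have nn: "0 \<le> PS R $ i $ x" for i x using *(1) by (simp add: I_def)
  moreover have "PS R $ i $ x \<le> 1" for i x
    using member_le_sum[of x UNIV "\<lambda>x. PS R $ i $ x"] nn t \<open>t = 1\<close> by auto
  ultimately show ?thesis
    using col1 t by (simp add: random_assignment_def col_def)
qed


text \<open>
  A rule is a total function on families of relations, but all conditions only concern its values
  on \<open>profiles\<close>.
\<close>

definition random_assignment_rule ::
    "(('a::finite, 'o::finite) profile \<Rightarrow> ('a, 'o) assignment) \<Rightarrow> bool" where
  "random_assignment_rule f \<longleftrightarrow> (\<forall>R\<in>profiles. random_assignment (f R))"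

definition extension_of_PS ::
    "(('a::finite, 'o::finite) profile \<Rightarrow> ('a, 'o) assignment) \<Rightarrow> bool" where
  "extension_of_PS f \<longleftrightarrow> (\<forall>R\<in>profiles. (\<forall>i. strict_pref (R i)) \<longrightarrow> f R = PS R)"

definition ex_post_efficient_rule ::
    "(('a::finite, 'o::finite) profile \<Rightarrow> ('a, 'o) assignment) \<Rightarrow> bool" where
  "ex_post_efficient_rule f \<longleftrightarrow> (\<forall>R\<in>profiles. ex_post_efficient R (f R))"

definition weak_sd_strategyproof ::
    "(('a::finite, 'o::finite) profile \<Rightarrow> ('a, 'o) assignment) \<Rightarrow> bool" where
  "weak_sd_strategyproof f \<longleftrightarrow>
     (\<forall>R\<in>profiles. \<forall>i. \<forall>R'\<in>preferences.
        \<not> sd_strict (R i) (f (R(i := R')) $ i) (f R $ i))"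

end

theory Submission
  imports Defs
begin

text \<open>
  For three agents consider the profile where agent 1 has \<open>{a, b} \<succ> c\<close> (with \<open>a\<close> and \<open>b\<close>
  indifferent), agent 2 has \<open>a \<succ> b \<succ> c\<close> and agent 3 has \<open>a \<succ> c \<succ> b\<close>. A Pareto optimal
  assignment never gives \<open>a\<close> to agent 1, who could hand it over for \<open>b\<close> at no cost. So an ex post
  efficient rule gives agent 1 the object \<open>b\<close> with some probability \<open>s\<close>, and \<open>c\<close> otherwise.
  Reporting \<open>a \<succ> b \<succ> c\<close> gives agent 1 the serial shares \<open>1/3\<close>, \<open>1/2\<close>, \<open>1/6\<close> of \<open>a\<close>, \<open>b\<close>, \<open>c\<close>,
  hence \<open>s \<ge> 5/6\<close>. An agent 1 with true preference \<open>b \<succ> a \<succ> c\<close> has the serial shares \<open>0\<close>, \<open>3/4\<close>,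
  \<open>1/4\<close> and may pretend to be indifferent, hence \<open>s \<le> 3/4\<close>. For larger \<open>n\<close>, every additional agent
  has its own favourite object, and agents 1, 2, 3 rank these objects last.
\<close>

section \<open>Preferences given by ranks\<close>

definition by_rank :: "('o \<Rightarrow> nat) \<Rightarrow> 'o pref" where
  "by_rank r x y \<longleftrightarrow> r x \<le> r y"

lemma by_rank_preferences [simp]: "by_rank r \<in> preferences"
  by (auto simp: preferences_def by_rank_def transp_def)

lemma strict_pref_by_rank: "inj r \<Longrightarrow> strict_pref (by_rank r)"
  by (auto simp: strict_pref_def by_rank_def dest: injD)

text \<open>The default \<open>to_nat\<close> orders the unlisted objects injectively, and each
  \<open>Suc\<close> pushes them below the listed ones. Every list thus yields a strict
  preference.\<close>

primrec list_rank :: "'o::countable list \<Rightarrow> 'o \<Rightarrow> nat" where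
  "list_rank [] x = to_nat x"
| "list_rank (y # ys) x = (if x = y then 0 else Suc (list_rank ys x))"

lemma inj_list_rank: "inj (list_rank ys)"
  by (induction ys) (auto simp: inj_def)

section \<open>Discrete assignments as bijections\<close>

definition assignment_of :: "('a::finite \<Rightarrow> 'o::finite) \<Rightarrow> ('a, 'o) assignment" where
  "assignment_of \<sigma> = (\<chi> i x. if x = \<sigma> i then 1 else 0)"

lemma assignment_of_nth [simp]: "assignment_of \<sigma> $ i $ x = (if x = \<sigma> i then 1 else 0)"
  by (simp add: assignment_of_def)

lemma random_assignment_of:
  assumes "bij \<sigma>"
  shows "random_assignment (assignment_of \<sigma>)"
proof -
  have "(\<Sum>i\<in>UNIV. if x = \<sigma> i then 1 else (0::real)) = 1" for x
  proof -
    have "(x = \<sigma> i) = (i = inv \<sigma> x)" for i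
      using assms by (metis bij_inv_eq_iff)
    then show ?thesis by simp
  qed
  then show ?thesis by (simp add: random_assignment_def)
qed

lemma discrete_assignment_bij:
  assumes "discrete_assignment q"
  obtains \<sigma> where "bij \<sigma>" "q = assignment_of \<sigma>"
proof -
  have row: "(\<Sum>x\<in>UNIV. q $ i $ x) = 1" and col: "(\<Sum>i\<in>UNIV. q $ i $ x) = 1"
    and nn: "0 \<le> q $ i $ x" and q01: "q $ i $ x = 0 \<or> q $ i $ x = 1" for i x
    using assms by (auto simp: discrete_assignment_def random_assignment_def)
  have "\<exists>x. q $ i $ x = 1" for i
  proof (rule ccontr)
    assume "\<nexists>x. q $ i $ x = 1"
    then have "(\<Sum>x\<in>UNIV. q $ i $ x) = 0" using q01 by (intro sum.neutral) blast
    then show False using row[of i] by simp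
  qed
  then obtain \<sigma> where \<sigma>: "\<And>i. q $ i $ \<sigma> i = 1" by metis
  have uniq: "x = \<sigma> i" if "q $ i $ x = 1" for i x
  proof (rule ccontr)
    assume "x \<noteq> \<sigma> i"
    then have "2 = (\<Sum>y\<in>{x, \<sigma> i}. q $ i $ y)" using that \<sigma> by simp
    also have "\<dots> \<le> (\<Sum>y\<in>UNIV. q $ i $ y)" by (intro sum_mono2) (auto simp: nn)
    finally show False using row[of i] by simp
  qed
  have "inj \<sigma>"
  proof (rule injI, rule ccontr)
    fix i j assume "\<sigma> i = \<sigma> j" "i \<noteq> j"
    then have "2 = (\<Sum>k\<in>{i, j}. q $ k $ \<sigma> i)" using \<sigma>[of i] \<sigma>[of j] by simp
    also have "\<dots> \<le> (\<Sum>k\<in>UNIV. q $ k $ \<sigma> i)" by (intro sum_mono2) (auto simp: nn)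
    finally show False using col[of "\<sigma> i"] by simp
  qed
  moreover have "surj \<sigma>"
    unfolding surj_def
  proof
    fix x
    show "\<exists>i. x = \<sigma> i"
    proof (rule ccontr)
      assume "\<nexists>i. x = \<sigma> i"
      then have "(\<Sum>i\<in>UNIV. q $ i $ x) = 0" using q01 uniq by (intro sum.neutral) blast
      then show False using col[of x] by simp
    qed
  qed
  moreover have "q = assignment_of \<sigma>"
    using q01 uniq \<sigma> by (auto simp: vec_eq_iff)
  ultimately show ?thesis using that by (auto simp: bij_def)
qed

text \<open>Each row is a point mass, so its upper sums are indicators. The threshold
  \<open>\<sigma> i\<close> gives one direction, transitivity the other.\<close>

lemma sd_weak_assignment_of:
  assumes "R \<in> preferences"
  shows "sd_weak R (assignment_of \<tau> $ i) (assignment_of \<sigma> $ i) \<longleftrightarrow> R (\<tau> i) (\<sigma> i)"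
proof -
  have refl: "R x x" and tr: "R x y \<Longrightarrow> R y z \<Longrightarrow> R x z" for x y z
    using assms by (auto simp: preferences_def dest: transpD)
  have "(\<Sum>x\<in>{x. R x y}. if x = \<rho> i then 1 else 0) = (if R (\<rho> i) y then 1 else (0::real))"
    for \<rho> :: "'b \<Rightarrow> 'a" and y
    by simp
  then show ?thesis
    using refl tr by (auto simp: sd_weak_def split: if_splits)
qed

text \<open>Reduces optimality to comparisons between bijections: a weak improvement for everybody
  must be indifference for everybody, since a strict gain would contradict SD-efficiency.\<close>

lemma pareto_optimal_bij:
  assumes "pareto_optimal R q" "R \<in> profiles"
  obtains \<sigma> where "bij \<sigma>" "q = assignment_of \<sigma>"
    "\<And>\<tau> i. bij \<tau> \<Longrightarrow> (\<And>j. R j (\<tau> j) (\<sigma> j)) \<Longrightarrow> R i (\<sigma> i) (\<tau> i)"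
proof -
  obtain \<sigma> where \<sigma>: "bij \<sigma>" "q = assignment_of \<sigma>"
    using assms(1) discrete_assignment_bij by (auto simp: pareto_optimal_def)
  have pref: "R i \<in> preferences" for i using assms(2) by (auto simp: profiles_def)
  have "R i (\<sigma> i) (\<tau> i)" if \<tau>: "bij \<tau>" "\<And>j. R j (\<tau> j) (\<sigma> j)" for \<tau> i
  proof (rule ccontr)
    assume "\<not> R i (\<sigma> i) (\<tau> i)"
    then have "\<not> sd_efficient R q"
      unfolding sd_efficient_def not_not \<sigma>(2) sd_strict_def
      using random_assignment_of[OF \<tau>(1)] \<tau>(2) pref by (metis sd_weak_assignment_of)
    then show False using assms(1) by (simp add: pareto_optimal_def)
  qed
  then show ?thesis using that \<sigma> by blast
qed

text \<open>The vanishing of an entry is a convex condition, so it passes to the convex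
  hull.\<close>

lemma ex_post_efficient_zero:
  assumes "ex_post_efficient R p" "\<And>q. pareto_optimal R q \<Longrightarrow> q $ i $ x = 0"
  shows "p $ i $ x = 0"
proof -
  have "convex {q :: ('a, 'b) assignment. q $ i $ x = 0}"
    by (auto simp: convex_def)
  then have "convex hull {q. pareto_optimal R q} \<subseteq> {q. q $ i $ x = 0}"
    using assms(2) by (intro hull_minimal) auto
  then show ?thesis using assms(1) by (auto simp: ex_post_efficient_def)
qed

section \<open>Phases of the serial rule\<close>

lemma ps_eats_eq:
  assumes "strict_pref (R i)" "x \<in> ps_available p" "\<And>y. y \<in> ps_available p \<Longrightarrow> R i x y"
  shows "ps_eats R p i = (\<lambda>y. y = x)"
  using assms by (auto simp: ps_eats_def strict_pref_def fun_eq_iff)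

text \<open>Certifies a guessed duration \<open>d\<close> without computing the minimum: after time
  \<open>d\<close> no eaten object is overdrawn (\<open>dur\<close>) and that of \<open>i0\<close>
  is exactly used up. Here \<open>c\<close> gives the amounts already eaten, \<open>B\<close> what
  each agent eats and \<open>k\<close> the number of eaters.\<close>

lemma ps_phase_unfold:
  fixes R :: "('a::finite, 'o::finite) profile"
  assumes strict: "\<And>i. strict_pref (R i)"
    and col: "\<And>x. (\<Sum>i\<in>UNIV. p $ i $ x) = c x"
    and best: "\<And>i. c (B i) < 1" "\<And>i y. c y < 1 \<Longrightarrow> R i (B i) y"
    and k: "\<And>x. card {i. B i = x} = k x"
    and dur: "\<And>i. c (B i) + real (k (B i)) * d \<le> 1"
    and i0: "c (B i0) + real (k (B i0)) * d = 1"
  shows "(\<Sum>i\<in>UNIV. ps_phase R p $ i $ x) = c x + real (k x) * d"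
    and "ps_phase R p $ i $ x = p $ i $ x + (if x = B i then d else 0)"
proof -
  have av: "ps_available p = {x. c x < 1}" by (simp add: ps_available_def col)
  have eats: "ps_eats R p i = (\<lambda>y. y = B i)" for i
    using strict best by (intro ps_eats_eq) (auto simp: av)
  have kpos: "k (B i) > 0" for i
    unfolding k[symmetric] by (auto simp: card_gt_0_iff)
  have "ps_duration R p = Min {(1 - c x) / real (k x) | x. \<exists>i. B i = x}"
    by (simp add: ps_duration_def col eats k eq_commute[of _ "B _"])
  also have "\<dots> = d"
  proof (rule Min_eqI)
    fix y assume "y \<in> {(1 - c x) / real (k x) | x. \<exists>i. B i = x}"
    then obtain i where "y = (1 - c (B i)) / real (k (B i))" by blast
    then show "d \<le> y" using dur[of i] kpos[of i] by (simp add: pos_le_divide_eq mult.commute)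
  next
    have "d = (1 - c (B i0)) / real (k (B i0))"
      using i0 kpos[of i0] by (simp add: field_simps)
    then show "d \<in> {(1 - c x) / real (k x) | x. \<exists>i. B i = x}" by blast
  qed simp
  finally show phase: "ps_phase R p $ i $ x = p $ i $ x + (if x = B i then d else 0)" for i x
    by (simp add: ps_phase_def eats)
  show "(\<Sum>i\<in>UNIV. ps_phase R p $ i $ x) = c x + real (k x) * d"
    by (simp add: phase sum.distrib col sum.If_cases k eq_commute[of x])
qed

lemma ps_phase_exhausted: "ps_available p = {} \<Longrightarrow> ps_phase R p = p"
  by (simp add: ps_phase_def ps_eats_def vec_eq_iff)

text \<open>Lets the process stop after \<open>m\<close> phases although \<open>PS\<close> runs
  \<open>CARD('o)\<close> of them, so that three phases serve for every number of agents.\<close>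

lemma PS_eq_if_exhausted:
  fixes R :: "('a::finite, 'o::finite) profile"
  assumes "ps_available ((ps_phase R ^^ m) 0) = {}" "m \<le> CARD('o)"
  shows "PS R = (ps_phase R ^^ m) 0"
proof -
  have "(ps_phase R ^^ (k + m)) 0 = (ps_phase R ^^ m) 0" for k
    by (induction k) (simp_all add: ps_phase_exhausted assms(1))
  from this[of "CARD('o) - m"] show ?thesis using assms(2) by (simp add: PS_def)
qed

section \<open>The three profiles\<close>

text \<open>
  The bijection \<open>h\<close> names the objects \<open>a\<close>, \<open>b\<close>, \<open>c\<close> after the agents 1, 2, 3, and gives every
  other agent its favourite object.
\<close>

locale three_agents =
  fixes h :: "'a::finite \<Rightarrow> 'o::finite" and i1 i2 i3 :: 'a
  assumes bij_h: "bij h" and distinct: "i1 \<noteq> i2" "i1 \<noteq> i3" "i2 \<noteq> i3"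
begin

abbreviation "a \<equiv> h i1"
abbreviation "b \<equiv> h i2"
abbreviation "c \<equiv> h i3"

lemma h_eq [simp]: "h i = h j \<longleftrightarrow> i = j"
  using bij_h by (auto simp: bij_def dest: injD)

lemmas distinct_simps [simp] = distinct distinct[symmetric]

lemma object_cases: obtains j where "x = h j"
  using bij_h by (metis bij_pointE)

lemma all_objects: "(\<And>j. P (h j)) \<Longrightarrow> P x"
  by (metis object_cases)

lemma card_ge_3: "3 \<le> CARD('o)"
proof -
  have "card {a, b, c} \<le> CARD('o)" by (intro card_mono) auto
  then show ?thesis by simp
qed

text \<open>Only the report of agent 1 varies, so a misreport of agent 1 given by ranks leads to
  another profile of this form (\<open>prof_upd\<close>).\<close>

definition prof :: "('o \<Rightarrow> nat) \<Rightarrow> ('a, 'o) profile" where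
  "prof r i = by_rank (if i = i1 then r else if i = i2 then list_rank [a, b, c]
     else if i = i3 then list_rank [a, c, b] else list_rank [h i])"

text \<open>Lifting \<open>b\<close> to the rank of \<open>a\<close> creates the only tie; rank 1
  stays vacant.\<close>

definition indifferent_rank :: "'o \<Rightarrow> nat" where
  "indifferent_rank x = list_rank [a, b, c] (if x = b then a else x)"

lemma prof_profiles [simp]: "prof r \<in> profiles"
  by (simp add: profiles_def prof_def)

lemma prof_i1 [simp]: "prof r i1 = by_rank r"
  by (simp add: prof_def)

lemma prof_upd [simp]: "(prof r)(i1 := by_rank r') = prof r'"
  by (auto simp: prof_def)

lemma strict_prof: "inj r \<Longrightarrow> strict_pref (prof r i)"
  unfolding prof_def by (intro strict_pref_by_rank) (simp del: list_rank.simps add: inj_list_rank)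

section \<open>Bookkeeping for one eating phase, with objects indexed by agents through
  \<open>h\<close>\<close>

definition per_agent :: "'b \<Rightarrow> 'b \<Rightarrow> 'b \<Rightarrow> ('a \<Rightarrow> 'b) \<Rightarrow> 'a \<Rightarrow> 'b" where
  "per_agent x y z g i = (if i = i1 then x else if i = i2 then y else if i = i3 then z else g i)"

lemma per_agent_simps [simp]:
  "per_agent x y z g i1 = x" "per_agent x y z g i2 = y" "per_agent x y z g i3 = z"
  "i \<notin> {i1, i2, i3} \<Longrightarrow> per_agent x y z g i = g i"
  by (auto simp: per_agent_def)

lemma per_agent_less_1:
  "per_agent x y z g i < (1 :: real) \<longleftrightarrow>
     (i = i1 \<longrightarrow> x < 1) \<and> (i = i2 \<longrightarrow> y < 1) \<and> (i = i3 \<longrightarrow> z < 1) \<and>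
     (i \<notin> {i1, i2, i3} \<longrightarrow> g i < 1)"
  by (simp add: per_agent_def)

text \<open>Counts the agents eating \<open>h j\<close> when the three agents eat
  \<open>h g1\<close>, \<open>h g2\<close>, \<open>h g3\<close>. The last summand is agent
  \<open>j\<close> itself, eating its own favourite.\<close>

definition eaters :: "'a \<Rightarrow> 'a \<Rightarrow> 'a \<Rightarrow> 'a \<Rightarrow> nat" where
  "eaters g1 g2 g3 j = of_bool (g1 = j) + of_bool (g2 = j) + of_bool (g3 = j)
     + of_bool (j \<notin> {i1, i2, i3})"

lemma card_eaters: "card {i. per_agent g1 g2 g3 id i = j} = eaters g1 g2 g3 j"
proof -
  let ?G = "per_agent g1 g2 g3 id" and ?S = "{i1, i2, i3}"
  have "card {i. ?G i = j} = (\<Sum>i\<in>UNIV. of_bool (?G i = j))" by simp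
  also have "\<dots> = (\<Sum>i\<in>UNIV - ?S. of_bool (?G i = j)) + (\<Sum>i\<in>?S. of_bool (?G i = j))"
    by (rule sum.subset_diff) auto
  also have "(\<Sum>i\<in>UNIV - ?S. of_bool (?G i = j)) = (\<Sum>i\<in>UNIV - ?S. if i = j then 1 else 0 :: nat)"
    by (rule sum.cong) auto
  also have "\<dots> = of_bool (j \<notin> ?S)" by simp
  also have "(\<Sum>i\<in>?S. of_bool (?G i = j)) = of_bool (g1 = j) + of_bool (g2 = j) + (of_bool (g3 = j) :: nat)"
    by simp
  finally show ?thesis by (simp only: eaters_def add_ac)
qed

text \<open>Four numbers describe the column sums: \<open>x\<close>, \<open>y\<close>,
  \<open>z\<close> for \<open>a\<close>, \<open>b\<close>, \<open>c\<close>, and a common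
  \<open>t\<close> for all other objects, each eaten by its own agent alone. The equation in
  \<open>dur\<close> reflects that in every phase considered below the object eaten by agent 2 runs
  out. Only the row of agent 1 is tracked, as only its incentives matter.\<close>

lemma phase:
  fixes r x y z t
  defines "u \<equiv> per_agent x y z (\<lambda>_. t)" and "R \<equiv> prof r"
  assumes inj: "inj r" and g: "{g1, g2, g3} \<subseteq> {i1, i2, i3}"
    and col: "\<And>j. (\<Sum>i\<in>UNIV. p $ i $ h j) = u j"
    and available: "u g1 < 1" "u g2 < 1" "u g3 < 1" "t < 1"
    and best: "\<And>j. u j < 1 \<Longrightarrow> r (h g1) \<le> r (h j)"
      "\<And>j. u j < 1 \<Longrightarrow> list_rank [a, b, c] (h g2) \<le> list_rank [a, b, c] (h j)"
      "\<And>j. u j < 1 \<Longrightarrow> list_rank [a, c, b] (h g3) \<le> list_rank [a, c, b] (h j)"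
    and dur: "u g1 + real (eaters g1 g2 g3 g1) * d \<le> 1" "u g2 + real (eaters g1 g2 g3 g2) * d = 1"
      "u g3 + real (eaters g1 g2 g3 g3) * d \<le> 1" "t + d \<le> 1"
  shows "(\<Sum>i\<in>UNIV. ps_phase R p $ i $ h j) = per_agent (x + real (eaters g1 g2 g3 i1) * d)
      (y + real (eaters g1 g2 g3 i2) * d) (z + real (eaters g1 g2 g3 i3) * d) (\<lambda>_. t + d) j"
    and "ps_phase R p $ i1 $ h j = p $ i1 $ h j + (if j = g1 then d else 0)"
proof -
  define G where "G = per_agent g1 g2 g3 id"
  have inv_h [simp]: "inv h (h j) = j" for j
    using bij_h by (simp add: bij_def)
  have col': "(\<Sum>i\<in>UNIV. p $ i $ x) = u (inv h x)" for x
    using col by (cases x rule: object_cases) simp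
  have other: "u i = t" "eaters g1 g2 g3 i = 1" if "i \<notin> {i1, i2, i3}" for i
    using that g by (auto simp: u_def eaters_def)
  have avail: "u (inv h (h (G i))) < 1" for i
    using available other[of i] unfolding inv_h G_def per_agent_def by auto
  have best': "R i (h (G i)) x" if "u (inv h x) < 1" for i x
    using that best
    by (cases x rule: object_cases) (simp add: R_def prof_def by_rank_def G_def per_agent_def)
  have card: "card {i. h (G i) = x} = eaters g1 g2 g3 (inv h x)" for x
    by (cases x rule: object_cases) (simp add: G_def card_eaters)
  have dur': "u (inv h (h (G i))) + real (eaters g1 g2 g3 (inv h (h (G i)))) * d \<le> 1" for i
    using dur other[of i] unfolding inv_h G_def per_agent_def by auto
  have dur2: "u (inv h (h (G i2))) + real (eaters g1 g2 g3 (inv h (h (G i2)))) * d = 1"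
    using dur by (simp add: G_def)
  note * = ps_phase_unfold[where R = R and B = "\<lambda>i. h (G i)",
      OF strict_prof[OF inj, folded R_def] col' avail best' card dur' dur2]
  show "ps_phase R p $ i1 $ h j = p $ i1 $ h j + (if j = g1 then d else 0)"
    using *(2)[of i1 "h j"] by (simp add: G_def)
  have "(\<Sum>i\<in>UNIV. ps_phase R p $ i $ h j) = u j + real (eaters g1 g2 g3 j) * d"
    using *(1)[of "h j"] by simp
  then show "(\<Sum>i\<in>UNIV. ps_phase R p $ i $ h j) = per_agent (x + real (eaters g1 g2 g3 i1) * d)
      (y + real (eaters g1 g2 g3 i2) * d) (z + real (eaters g1 g2 g3 i3) * d) (\<lambda>_. t + d) j"
    using other[of j] by (auto simp: u_def per_agent_def)
qed

section \<open>Serial shares of agent 1 under its two strict reports\<close>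

lemma PS_eq_phase3:
  assumes "\<And>j. (\<Sum>i\<in>UNIV. ps_phase R (ps_phase R (ps_phase R 0)) $ i $ h j) = 1"
  shows "PS R = ps_phase R (ps_phase R (ps_phase R 0))"
proof -
  have "ps_available ((ps_phase R ^^ 3) 0) = {}"
    unfolding ps_available_def using assms
    by (auto simp: numeral_3_eq_3) (metis object_cases less_irrefl)
  from PS_eq_if_exhausted[OF this card_ge_3] show ?thesis by (simp add: numeral_3_eq_3)
qed

text \<open>All three share \<open>a\<close> until time 1/3. Then agents 1 and 2 halve
  \<open>b\<close> while agent 3 eats half of \<open>c\<close>, until 5/6. The other half of
  \<open>c\<close> is split three ways.\<close>

lemma PS_abc:
  defines "R \<equiv> prof (list_rank [a, b, c])"
  shows "PS R $ i1 $ h j = per_agent (1/3) (1/2) (1/6) (\<lambda>_. 0) j"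
proof -
  let ?p1 = "ps_phase R 0"
  let ?p2 = "ps_phase R ?p1"
  let ?p3 = "ps_phase R ?p2"
  note phase = phase[where r = "list_rank [a, b, c]", OF inj_list_rank, folded R_def]
  have 1: "(\<Sum>i\<in>UNIV. ?p1 $ i $ h j) = per_agent 1 0 0 (\<lambda>_. 1/3) j"
    "?p1 $ i1 $ h j = (if j = i1 then 1/3 else 0)" for j
    using phase[where p = 0 and d = "1/3" and x = 0 and y = 0 and z = 0 and t = 0 and j = j
        and ?g1.0 = i1 and ?g2.0 = i1 and ?g3.0 = i1]
    by (simp_all add: per_agent_def eaters_def)
  have 2: "(\<Sum>i\<in>UNIV. ?p2 $ i $ h j) = per_agent 1 1 (1/2) (\<lambda>_. 5/6) j"
    "?p2 $ i1 $ h j = ?p1 $ i1 $ h j + (if j = i2 then 1/2 else 0)" for j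
    using phase[where p = ?p1 and d = "1/2" and x = 1 and y = 0 and z = 0 and t = "1/3" and j = j
        and ?g1.0 = i2 and ?g2.0 = i2 and ?g3.0 = i3]
    by (simp_all add: 1 per_agent_less_1 eaters_def)
  have 3: "(\<Sum>i\<in>UNIV. ?p3 $ i $ h j) = per_agent 1 1 1 (\<lambda>_. 1) j"
    "?p3 $ i1 $ h j = ?p2 $ i1 $ h j + (if j = i3 then 1/6 else 0)" for j
    using phase[where p = ?p2 and d = "1/6" and x = 1 and y = 1 and z = "1/2" and t = "5/6" and j = j
        and ?g1.0 = i3 and ?g2.0 = i3 and ?g3.0 = i3]
    by (simp_all add: 2 per_agent_less_1 eaters_def)
  have "PS R = ?p3"
    by (rule PS_eq_phase3) (simp add: 3 per_agent_def)
  then show ?thesis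
    by (simp add: 1 2 3 per_agent_def)
qed

text \<open>Agent 1 eats \<open>b\<close> alone while agents 2 and 3 halve \<open>a\<close>, until
  time 1/2. Agent 2 then joins at \<open>b\<close>, which runs out at 3/4, when agent 3 has eaten a
  quarter of \<open>c\<close>. The remaining 3/4 of \<open>c\<close> is split three ways.\<close>

lemma PS_bac:
  defines "R \<equiv> prof (list_rank [b, a, c])"
  shows "PS R $ i1 $ h j = per_agent 0 (3/4) (1/4) (\<lambda>_. 0) j"
proof -
  let ?p1 = "ps_phase R 0"
  let ?p2 = "ps_phase R ?p1"
  let ?p3 = "ps_phase R ?p2"
  note phase = phase[where r = "list_rank [b, a, c]", OF inj_list_rank, folded R_def]
  have 1: "(\<Sum>i\<in>UNIV. ?p1 $ i $ h j) = per_agent 1 (1/2) 0 (\<lambda>_. 1/2) j"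
    "?p1 $ i1 $ h j = (if j = i2 then 1/2 else 0)" for j
    using phase[where p = 0 and d = "1/2" and x = 0 and y = 0 and z = 0 and t = 0 and j = j
        and ?g1.0 = i2 and ?g2.0 = i1 and ?g3.0 = i1]
    by (simp_all add: per_agent_def eaters_def)
  have 2: "(\<Sum>i\<in>UNIV. ?p2 $ i $ h j) = per_agent 1 1 (1/4) (\<lambda>_. 3/4) j"
    "?p2 $ i1 $ h j = ?p1 $ i1 $ h j + (if j = i2 then 1/4 else 0)" for j
    using phase[where p = ?p1 and d = "1/4" and x = 1 and y = "1/2" and z = 0 and t = "1/2" and j = j
        and ?g1.0 = i2 and ?g2.0 = i2 and ?g3.0 = i3]
    by (simp_all add: 1 per_agent_less_1 eaters_def)
  have 3: "(\<Sum>i\<in>UNIV. ?p3 $ i $ h j) = per_agent 1 1 1 (\<lambda>_. 1) j"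
    "?p3 $ i1 $ h j = ?p2 $ i1 $ h j + (if j = i3 then 1/4 else 0)" for j
    using phase[where p = ?p2 and d = "1/4" and x = 1 and y = 1 and z = "1/4" and t = "3/4" and j = j
        and ?g1.0 = i3 and ?g2.0 = i3 and ?g3.0 = i3]
    by (simp_all add: 2 per_agent_less_1 eaters_def)
  have "PS R = ?p3"
    by (rule PS_eq_phase3) (simp add: 3 per_agent_def)
  then show ?thesis
    by (simp add: 1 2 3 per_agent_def)
qed

section \<open>Pareto optimality when agent 1 is indifferent between \<open>a\<close> and
  \<open>b\<close>\<close>

lemma pareto_optimal_i1:
  assumes "pareto_optimal (prof indifferent_rank) q" "x \<notin> {b, c}"
  shows "q $ i1 $ x = 0"
proof -
  let ?R = "prof indifferent_rank"
  define S where "S = {i1, i2, i3}"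
  obtain \<sigma> where \<sigma>: "bij \<sigma>" "q = assignment_of \<sigma>"
    and opt: "\<And>\<tau> i. bij \<tau> \<Longrightarrow> (\<And>j. ?R j (\<tau> j) (\<sigma> j)) \<Longrightarrow> ?R i (\<sigma> i) (\<tau> i)"
    using pareto_optimal_bij[OF assms(1)] by auto
  have inj: "inj \<sigma>" and inj_h: "inj h" using \<sigma>(1) bij_h by (auto simp: bij_def)
  have inj': "inj_on \<sigma> A" and inj_h': "inj_on h A" for A
    using inj inj_h by (auto elim: inj_on_subset)
  have abc_first: "?R j x y" if "j \<in> S" "x \<in> h ` S" "y \<notin> h ` S" for j x y
    using that by (auto simp: prof_def by_rank_def S_def indifferent_rank_def)
  \<comment> \<open>The competitor \<open>\<tau>\<close> gives outside agents their favourites, lets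
    the agents in \<open>D\<close> keep what they hold, and uses \<open>\<beta>\<close> to hand the
    rest of \<open>a\<close>, \<open>b\<close>, \<open>c\<close> to the other members of
    \<open>S\<close>. These held objects ranked below all three, so nobody loses, and optimality
    forces \<open>\<sigma> i\<close> to be the unique top object of \<open>i\<close>.\<close>
  have fav: "\<sigma> i = h i" if i: "i \<notin> S" for i
  proof -
    define D where "D = {i \<in> S. \<sigma> i \<in> h ` S}"
    have "card (S - D) = card S - card D" "card (h ` S - \<sigma> ` D) = card (h ` S) - card (\<sigma> ` D)"
      by (auto intro!: card_Diff_subset simp: D_def)
    moreover have "card (h ` S) = card S" "card (\<sigma> ` D) = card D"
      by (simp_all add: card_image inj_h' inj')
    ultimately have "card (S - D) = card (h ` S - \<sigma> ` D)" by simp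
    then obtain \<beta> where \<beta>: "bij_betw \<beta> (S - D) (h ` S - \<sigma> ` D)"
      using finite_same_card_bij[OF finite finite] by blast
    define \<tau> where "\<tau> i = (if i \<notin> S then h i else if i \<in> D then \<sigma> i else \<beta> i)" for i
    have "bij_betw \<tau> D (\<sigma> ` D)"
      by (subst bij_betw_cong[where g = \<sigma>]) (auto simp: \<tau>_def D_def bij_betw_def inj')
    moreover have "bij_betw \<tau> (S - D) (h ` S - \<sigma> ` D)"
      using \<beta> by (subst bij_betw_cong[where g = \<beta>]) (auto simp: \<tau>_def)
    ultimately have "bij_betw \<tau> (D \<union> (S - D)) (\<sigma> ` D \<union> (h ` S - \<sigma> ` D))"
      by (rule bij_betw_combine) blast
    moreover have "bij_betw \<tau> (- S) (- h ` S)"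
      by (subst bij_betw_cong[where g = h])
        (simp_all add: \<tau>_def bij_betw_def bij_image_Compl_eq[OF bij_h] inj_h')
    ultimately have "bij_betw \<tau> (D \<union> (S - D) \<union> - S) (\<sigma> ` D \<union> (h ` S - \<sigma> ` D) \<union> - h ` S)"
      by (rule bij_betw_combine) (auto simp: D_def)
    moreover have "D \<union> (S - D) \<union> - S = UNIV" "\<sigma> ` D \<union> (h ` S - \<sigma> ` D) \<union> - h ` S = UNIV"
      by (auto simp: D_def)
    ultimately have "bij \<tau>" by simp
    moreover have "?R j (\<tau> j) (\<sigma> j)" for j
    proof -
      consider "j \<notin> S" | "j \<in> D" | "j \<in> S" "\<tau> j \<in> h ` S" "\<sigma> j \<notin> h ` S"
        using bij_betwE[OF \<beta>] by (auto simp: D_def \<tau>_def)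
      then show ?thesis
      proof cases
        case 1
        then show ?thesis by (simp add: \<tau>_def prof_def by_rank_def S_def)
      next
        case 2
        then show ?thesis by (simp add: \<tau>_def prof_def by_rank_def D_def)
      next
        case 3
        then show ?thesis by (intro abc_first)
      qed
    qed
    ultimately have "?R i (\<sigma> i) (\<tau> i)" by (rule opt)
    then show ?thesis
      using i by (simp add: \<tau>_def prof_def by_rank_def S_def split: if_splits)
  qed
  have "\<sigma> i1 \<in> {b, c}"
  proof (rule ccontr)
    assume nbc: "\<sigma> i1 \<notin> {b, c}"
    obtain j where j: "\<sigma> i1 = h j" by (rule object_cases)
    have "j \<in> S"
      using fav[of j] j inj by (metis S_def injD insertI1)
    then have a: "\<sigma> i1 = a" using j nbc by (auto simp: S_def)
    obtain k where k: "\<sigma> k = b" using \<sigma>(1) by (metis bij_pointE)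
    have "k \<in> S" using fav[of k] k by (auto simp: S_def)
    moreover have "k \<noteq> i1" using a k by auto
    ultimately have k23: "k = i2 \<or> k = i3" by (auto simp: S_def)
    \<comment> \<open>Agent 1 trades \<open>a\<close> for the equally good \<open>b\<close>. By
      \<open>fav\<close> the partner \<open>k\<close> is agent 2 or 3, both of whom rank
      \<open>a\<close> first, so \<open>k\<close> gains strictly.\<close>
    define \<tau> where "\<tau> = \<sigma>(i1 := b, k := a)"
    have "\<tau> = \<sigma> \<circ> Transposition.transpose i1 k"
      using a k \<open>k \<noteq> i1\<close> by (auto simp: \<tau>_def Transposition.transpose_def)
    then have "bij \<tau>" using \<sigma>(1) by (simp add: bij_comp)
    moreover have "?R j (\<tau> j) (\<sigma> j)" for j
      using a k k23 \<open>k \<noteq> i1\<close>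
      by (auto simp: \<tau>_def prof_def by_rank_def indifferent_rank_def)
    ultimately have "?R k (\<sigma> k) (\<tau> k)" by (rule opt)
    then show False
      using k k23 by (auto simp: \<tau>_def prof_def by_rank_def)
  qed
  then show ?thesis using assms(2) \<sigma>(2) by auto
qed

section \<open>Incentives of agent 1 and the contradiction\<close>

lemma sum_upper:
  fixes v :: "real ^ 'o"
  assumes "\<And>j. v $ h j = per_agent u1 u2 u3 (\<lambda>_. 0) j"
  shows "(\<Sum>x\<in>{x. by_rank r x y}. v $ x) = (if r a \<le> r y then u1 else 0) +
    (if r b \<le> r y then u2 else 0) + (if r c \<le> r y then u3 else 0)"
proof -
  have "v $ x = 0" if "x \<notin> {a, b, c}" for x
    using that assms by (cases x rule: object_cases) simp
  then have "(\<Sum>x\<in>{x. by_rank r x y}. v $ x) = (\<Sum>x\<in>{x \<in> {a, b, c}. by_rank r x y}. v $ x)"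
    by (intro sum.mono_neutral_right) auto
  also have "\<dots> = (\<Sum>x\<in>{a, b, c}. if by_rank r x y then v $ x else 0)"
    by (intro sum.inter_filter) simp
  finally show ?thesis by (simp add: assms by_rank_def)
qed

lemma no_rule:
  fixes f :: "('a, 'o) profile \<Rightarrow> ('a, 'o) assignment"
  assumes "random_assignment_rule f" "extension_of_PS f"
    and "ex_post_efficient_rule f" "weak_sd_strategyproof f"
  shows False
proof -
  let ?ind = "f (prof indifferent_rank)"
  let ?abc = "f (prof (list_rank [a, b, c]))" and ?bac = "f (prof (list_rank [b, a, c]))"
  define s where "s = ?ind $ i1 $ b"
  have zero: "?ind $ i1 $ x = 0" if "x \<notin> {b, c}" for x
    using assms(3) that
    by (intro ex_post_efficient_zero[OF _ pareto_optimal_i1]) (auto simp: ex_post_efficient_rule_def)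
  have "1 = (\<Sum>x\<in>UNIV. ?ind $ i1 $ x)"
    using assms(1) by (simp add: random_assignment_rule_def random_assignment_def)
  also have "\<dots> = (\<Sum>x\<in>{b, c}. ?ind $ i1 $ x)"
    by (intro sum.mono_neutral_right) (auto simp: zero)
  finally have ind: "?ind $ i1 $ h j = per_agent 0 s (1 - s) (\<lambda>_. 0) j" for j
    using zero[of "h j"] by (auto simp: per_agent_def s_def)
  have PS: "f (prof (list_rank xs)) = PS (prof (list_rank xs))" for xs
    using assms(2) strict_prof[OF inj_list_rank] by (auto simp: extension_of_PS_def)
  note abc = PS_abc[folded PS] and bac = PS_bac[folded PS]
  have sp: "\<not> sd_strict (by_rank r) (f (prof r') $ i1) (f (prof r) $ i1)" for r r'
    using assms(4) prof_profiles by_rank_preferences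
    unfolding weak_sd_strategyproof_def by (metis prof_i1 prof_upd)
  have "s \<ge> 5/6"
  proof (rule ccontr)
    assume "\<not> s \<ge> 5/6"
    \<comment> \<open>At threshold \<open>a\<close> the upper set contains \<open>a\<close> and
      \<open>b\<close>, with mass 1/3 + 1/2 = 5/6 against \<open>s\<close>. From \<open>c\<close>
      downwards both sums are 1.\<close>
    then have "sd_strict (by_rank indifferent_rank) (?abc $ i1) (?ind $ i1)"
      unfolding sd_strict_def sd_weak_def sum_upper[OF abc] sum_upper[OF ind]
      by (auto simp: indifferent_rank_def intro!: exI[of _ a])
    then show False using sp by blast
  qed
  moreover have "s \<le> 3/4"
  proof (rule ccontr)
    assume "\<not> s \<le> 3/4"
    \<comment> \<open>At threshold \<open>b\<close> the masses are \<open>s\<close> and 3/4. Both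
      rows vanish at \<open>a\<close>, so that threshold gives the same comparison, and from
      \<open>c\<close> downwards both sums are 1.\<close>
    then have "sd_strict (by_rank (list_rank [b, a, c])) (?ind $ i1) (?bac $ i1)"
      unfolding sd_strict_def sd_weak_def sum_upper[OF bac] sum_upper[OF ind]
      by (auto intro!: exI[of _ b])
    then show False using sp by blast
  qed
  ultimately show False by simp
qed

end

theorem theorem1:
  fixes n :: nat
  assumes "n \<ge> 3"
    and "CARD('a::finite) = n"
    and "CARD('o::finite) = n"
  shows "\<not> (\<exists>f :: ('a, 'o) profile \<Rightarrow> ('a, 'o) assignment.
    random_assignment_rule f \<and> extension_of_PS f \<and>
    ex_post_efficient_rule f \<and> weak_sd_strategyproof f)"
proof -
  obtain h :: "'a \<Rightarrow> 'o" where "bij h"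
    using finite_same_card_bij[of "UNIV :: 'a set" "UNIV :: 'o set"] assms by auto
  obtain A :: "'a set" where "card A = 3"
    using obtain_subset_with_card_n[of 3 "UNIV :: 'a set"] assms by auto
  then obtain i1 i2 i3 :: 'a where "i1 \<noteq> i2" "i1 \<noteq> i3" "i2 \<noteq> i3"
    by (auto simp: card_3_iff)
  then interpret three_agents h i1 i2 i3
    using \<open>bij h\<close> by unfold_locales
  show ?thesis using no_rule by blast
qed

end
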